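(* Let $R$ be a ring, $G$ a group and $RG$ the group ring of $G$ over $R$. If $RG$ is a $W\Delta U$ ring and $2\in\Delta(RG)$, then $G$ must be a $2$-group.
   Context: Rings are associative with identity, not necessarily commutative. A $2$-group is a group in which every element has (finite) order a power of $2$. $U(S)$ is the group of units of a ring $S$. $\Delta(S)=\{r\in S : r+u\in U(S)\text{ for all }u\in U(S)\}$; equivalently $\Delta(S)=J(T)$, where $T$ is the subring of $S$ generated by $U(S)$ and $J$ denotes the Jacobson radical. $S$ is $W\Delta U$ if $U(S)=\pm 1+\Delta(S)$, i.e. every unit of $S$ has the form $1+d$ or $-1+d$ with $d\in\Delta(S)$. *)

theory Defs
  imports "HOL-Library.Poly_Mapping"
begin

(* The finitely supported functions from G to R, with the convolution product of Poly_Mapping,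
   form the group ring RG. Isabelle's group classes are additive, so the (possibly
   non-commutative) group G is written additively: "+" is the group operation and 0 the identity.
   The class ring_1 does not require commutativity but does include 0 \<noteq> 1. *)
type_synonym ('r, 'g) group_ring = "'g \<Rightarrow>\<^sub>0 'r"

(* Two-sided invertibility: "u dvd 1" is one-sided when multiplication is not commutative. *)
definition ring_units :: "'s::ring_1 set" where
  "ring_units = {u. \<exists>v. u * v = 1 \<and> v * u = 1}"

definition Delta :: "'s::ring_1 set" where
  "Delta = {r. \<forall>u\<in>ring_units. r + u \<in> ring_units}"

definition W_Delta_U :: "'s::ring_1 itself \<Rightarrow> bool" where
  "W_Delta_U TYPE('s) \<longleftrightarrow>
     (ring_units :: 's set) = {1 + d | d. d \<in> Delta} \<union> {- 1 + d | d. d \<in> Delta}"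

(* g "to the power" n, in additive notation *)
definition group_multiple :: "nat \<Rightarrow> 'g::group_add \<Rightarrow> 'g" where
  "group_multiple n g = ((+) g ^^ n) 0"

(* 0 stands for infinite order *)
definition group_element_order :: "'g::group_add \<Rightarrow> nat" where
  "group_element_order g =
     (if \<exists>n>0. group_multiple n g = 0 then LEAST n. n > 0 \<and> group_multiple n g = 0 else 0)"

definition two_group :: "'g::group_add itself \<Rightarrow> bool" where
  "two_group TYPE('g) \<longleftrightarrow> (\<forall>g::'g. \<exists>k::nat. group_element_order g = 2 ^ k)"

end

theory Submission
  imports Defs "HOL-Computational_Algebra.Euclidean_Algorithm"
begin

text \<open>
  Since 2 lies in \<open>\<Delta>\<close>, every unit is congruent to 1 modulo the additive group \<open>\<Delta>\<close>. Hence a sum of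
  an odd number of units is again a unit; in particular \<open>1 + g + \<dots> + g^(m-1)\<close> is a unit for odd
  \<open>m\<close>. If \<open>g\<close> has infinite order, comparing the coefficients of an inverse of \<open>1 + g + g^2\<close> along
  the powers of \<open>g\<close> gives a contradiction. If \<open>h\<close> has odd order \<open>m\<close>, then
  \<open>(1 - h)(1 + h + \<dots> + h^(m-1)) = 0\<close> forces \<open>h = 1\<close>; apply this to \<open>h = g^(2^k)\<close>, where \<open>2^k\<close> is
  the 2-part of the order of \<open>g\<close>.
\<close>

lemma ring_units_uminus: "- u \<in> ring_units" if "u \<in> ring_units" for u :: "'s::ring_1"
proof -
  from that obtain v where "u * v = 1" "v * u = 1"
    by (auto simp: ring_units_def)
  then have "- u * - v = 1" "- v * - u = 1"
    by simp_all
  then show ?thesis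
    unfolding ring_units_def by blast
qed

lemma Delta_add: "a + b \<in> Delta" if "a \<in> Delta" "b \<in> Delta" for a b :: "'s::ring_1"
  using that by (auto simp: Delta_def add.assoc)

lemma Delta_uminus: "- a \<in> Delta" if "a \<in> Delta" for a :: "'s::ring_1"
proof -
  have "- a + u \<in> ring_units" if u: "u \<in> ring_units" for u
  proof -
    have "a + - u \<in> ring_units"
      using \<open>a \<in> Delta\<close> ring_units_uminus[OF u] unfolding Delta_def by blast
    from ring_units_uminus[OF this] show ?thesis
      by simp
  qed
  then show ?thesis
    by (simp add: Delta_def)
qed

lemma one_plus_Delta_unit: "1 + d \<in> ring_units" if "d \<in> Delta" for d :: "'s::ring_1"
proof -
  have "(1 :: 's) \<in> ring_units"
    by (auto simp: ring_units_def)
  then have "d + 1 \<in> ring_units"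
    using that by (auto simp: Delta_def)
  then show ?thesis
    by (simp add: add.commute)
qed

text \<open>This merges the two signs: a unit \<open>- 1 + d\<close> equals
  \<open>1 + (d - 2)\<close>, and \<open>d - 2\<close> stays in \<open>Delta\<close> because 2
  does.\<close>

lemma W_Delta_U_unit_minus_one:
  fixes u :: "'s::ring_1"
  assumes "W_Delta_U TYPE('s)" "(2 :: 's) \<in> Delta" "u \<in> ring_units"
  shows "u - 1 \<in> Delta"
proof -
  from assms obtain d where d: "d \<in> Delta" "u = 1 + d \<or> u = - 1 + d"
    by (auto simp: W_Delta_U_def)
  then show ?thesis
  proof (elim disjE)
    assume "u = - 1 + d"
    moreover have "- 1 + d - 1 = d - (1 + 1)"
      by (simp only: diff_diff_eq[symmetric] uminus_add_conv_diff)
    ultimately have "u - 1 = d + - 2"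
      by simp
    then show ?thesis
      using Delta_add[OF d(1) Delta_uminus[OF assms(2)]] by simp
  qed simp
qed

lemma odd_sum_units:
  fixes u :: "nat \<Rightarrow> 's::ring_1"
  assumes W: "W_Delta_U TYPE('s)" and two: "(2 :: 's) \<in> Delta"
    and u: "\<And>i. u i \<in> ring_units" and m: "odd m"
  shows "(\<Sum>i<m. u i) \<in> ring_units"
proof -
  obtain k where k: "m = Suc (2 * k)"
    using m by (auto elim: oddE)
  have "(\<Sum>i<Suc (2 * k). u i) - 1 \<in> Delta"
  proof (induction k)
    case 0
    then show ?case
      using W_Delta_U_unit_minus_one[OF W two u] by simp
  next
    case (Suc k)
    \<comment> \<open>Two further units u and v add (u - 1) + (v - 1) + 2, a sum of three elements
      of \<open>Delta\<close>.\<close>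
    let ?a = "u (Suc (2 * k)) - 1" and ?b = "u (Suc (Suc (2 * k))) - 1"
    have "(\<Sum>i<Suc (2 * Suc k). u i) - 1 = ((\<Sum>i<Suc (2 * k). u i) - 1) + ((?a + ?b) + 2)"
      by (simp add: algebra_simps)
    then show ?case
      using Suc two W_Delta_U_unit_minus_one[OF W two u] by (simp only: Delta_add)
  qed
  from one_plus_Delta_unit[OF this] show ?thesis
    by (simp add: k)
qed

lemma group_multiple_0 [simp]: "group_multiple 0 g = 0"
  and group_multiple_Suc [simp]: "group_multiple (Suc n) g = g + group_multiple n g"
  by (simp_all add: group_multiple_def)

lemma group_multiple_add: "group_multiple (m + n) g = group_multiple m g + group_multiple n g"
  by (induction m) (simp_all add: add.assoc)

lemma group_multiple_mult: "group_multiple (m * n) g = group_multiple m (group_multiple n g)"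
  by (induction m) (simp_all add: group_multiple_add)

lemma inj_group_multiple:
  fixes g :: "'g::group_add"
  assumes "\<And>n. n > 0 \<Longrightarrow> group_multiple n g \<noteq> 0"
  shows "inj (\<lambda>n. group_multiple n g)"
proof (rule linorder_injI)
  fix m n :: nat
  assume "m < n"
  then have "group_multiple (n - m) g \<noteq> 0"
    using assms by simp
  moreover have "group_multiple n g = group_multiple m g + group_multiple (n - m) g"
    using \<open>m < n\<close> by (simp flip: group_multiple_add)
  ultimately show "group_multiple m g \<noteq> group_multiple n g"
    using add_left_cancel[of "group_multiple m g" "group_multiple (n - m) g" 0] by simp
qed

lemma single_unit: "Poly_Mapping.single g (1 :: 'r::ring_1) \<in> ring_units" for g :: "'g::group_add"
  unfolding ring_units_def by (rule CollectI, rule exI[of _ "Poly_Mapping.single (- g) 1"])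
    (simp add: mult_single)

lemma lookup_single_one_mult:
  fixes g h :: "'g::group_add" and v :: "'g \<Rightarrow>\<^sub>0 'r::ring_1"
  shows "Poly_Mapping.lookup (Poly_Mapping.single g 1 * v) h = Poly_Mapping.lookup v (- g + h)"
proof -
  have "(\<Sum>q. Poly_Mapping.lookup v q when h = g + q) = (\<Sum>q. Poly_Mapping.lookup v q when q = - g + h)"
    by (rule arg_cong[where f = Sum_any]) (auto simp: fun_eq_iff when_def add.assoc[symmetric])
  then show ?thesis
    by (simp add: lookup_mult lookup_single when_mult)
qed

text \<open>At the last index \<open>M\<close> of the support, the recurrence reduces to
  \<open>f M = 0\<close>.\<close>

lemma finite_support_recurrence_zero:
  fixes f :: "nat \<Rightarrow> 'r::ring_1"
  assumes "finite {n. f n \<noteq> 0}" and rec: "\<And>n. f n + f (Suc n) + f (Suc (Suc n)) = 0"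
  shows "f n = 0"
proof (rule ccontr)
  define M where "M = Max {n. f n \<noteq> 0}"
  assume "f n \<noteq> 0"
  then have "f M \<noteq> 0"
    using Max_in[OF assms(1)] unfolding M_def by auto
  moreover have "f k = 0" if "k > M" for k
    using Max_ge[OF assms(1), of k] that unfolding M_def by fastforce
  ultimately show False
    using rec[of M] by simp
qed

text \<open>Away from the identity the product has coefficient 0, so the coefficients of
  \<open>v\<close> satisfy a three-term recurrence along the positive and along the negative
  multiples of \<open>g\<close>. As \<open>v\<close> has finite support, both sequences
  vanish.\<close>

lemma trinomial_no_right_inverse:
  fixes g :: "'g::group_add" and v :: "'g \<Rightarrow>\<^sub>0 'r::ring_1"
  assumes inf: "\<And>n. n > 0 \<Longrightarrow> group_multiple n g \<noteq> 0"
  shows "(\<Sum>i<3. Poly_Mapping.single (group_multiple i g) 1) * v \<noteq> 1"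
proof
  assume eq: "(\<Sum>i<3. Poly_Mapping.single (group_multiple i g) 1) * v = 1"
  have coeff: "Poly_Mapping.lookup v h + Poly_Mapping.lookup v (- g + h)
      + Poly_Mapping.lookup v (- g + (- g + h)) = (1 when h = 0)"
    for h
    using arg_cong[OF eq, of "\<lambda>p. Poly_Mapping.lookup p h"]
    by (simp add: numeral_3_eq_3 distrib_right lookup_add lookup_single_one_mult minus_add
        add.assoc lookup_one diff_conv_add_uminus del: add_uminus_conv_diff)
  let ?n = "\<lambda>n. group_multiple n g"
  have inj: "inj ?n"
    by (rule inj_group_multiple[OF inf])
  have inj_neg: "inj (\<lambda>n. - ?n (Suc n))"
  proof (rule injI)
    fix m n
    assume "- ?n (Suc m) = - ?n (Suc n)"
    then have "?n (Suc m) = ?n (Suc n)"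
      by (simp only: neg_equal_iff_equal)
    from injD[OF inj this] show "m = n"
      by simp
  qed
  have fin: "finite {n. Poly_Mapping.lookup v (f n) \<noteq> 0}" if "inj f" for f :: "nat \<Rightarrow> 'g"
  proof -
    have "{n. Poly_Mapping.lookup v (f n) \<noteq> 0} = f -` Poly_Mapping.keys v"
      by (auto simp: in_keys_iff)
    then show ?thesis
      using finite_vimageI[OF finite_keys that, of v] by simp
  qed
  have up: "Poly_Mapping.lookup v (?n n) = 0" for n
  proof (rule finite_support_recurrence_zero[where f = "\<lambda>n. Poly_Mapping.lookup v (?n n)"])
    fix n
    show "Poly_Mapping.lookup v (?n n) + Poly_Mapping.lookup v (?n (Suc n))
        + Poly_Mapping.lookup v (?n (Suc (Suc n))) = 0"
      using coeff[of "?n (Suc (Suc n))"] inf[of "Suc (Suc n)"]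
      by (simp add: when_def ac_simps)
  qed (rule fin[OF inj])
  \<comment> \<open>The group need not be commutative and \<open>minus_add\<close> reverses the
    order; multiples of \<open>g\<close> commute with \<open>g\<close>, so \<open>- g\<close> can be
    moved to the left, where \<open>coeff\<close> has it.\<close>
  have comm: "?n n + g = g + ?n n" for n
    using group_multiple_add[of n 1 g] by simp
  have neg: "- ?n (Suc (Suc n)) = - g + - ?n (Suc n)" for n
    by (metis comm group_multiple_Suc minus_add)
  have down: "Poly_Mapping.lookup v (- ?n (Suc n)) = 0" for n
  proof (rule finite_support_recurrence_zero[where f = "\<lambda>n. Poly_Mapping.lookup v (- ?n (Suc n))"])
    fix n
    show "Poly_Mapping.lookup v (- ?n (Suc n)) + Poly_Mapping.lookup v (- ?n (Suc (Suc n)))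
        + Poly_Mapping.lookup v (- ?n (Suc (Suc (Suc n)))) = 0"
      \<comment> \<open>The sequence starts at \<open>- g\<close>, not at 0: at \<open>h = 0\<close>
        the right-hand side of \<open>coeff\<close> is 1 and the recurrence fails.\<close>
      using coeff[of "- ?n (Suc n)"] inf[of "Suc n"] unfolding neg[symmetric]
      by (simp add: when_def del: group_multiple_Suc)
  qed (rule fin[OF inj_neg])
  \<comment> \<open>At \<open>h = 0\<close> the three coefficients, at 0, \<open>- g\<close> and
    \<open>- g + - g\<close>, are all 0, yet they sum to 1.\<close>
  show False
    using coeff[of 0] up[of 0] down[of 0] down[of "Suc 0"] unfolding neg by simp
qed

theorem proposition4p15:
  assumes "W_Delta_U TYPE(('r::ring_1, 'g::group_add) group_ring)"
    and "(2 :: ('r, 'g) group_ring) \<in> Delta"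
  shows "two_group TYPE('g)"
proof -
  let ?s = "\<lambda>h::'g. Poly_Mapping.single h (1::'r)"
  have geometric: "(\<Sum>i<m. ?s (group_multiple i h)) \<in> ring_units" if "odd m" for m h
    using odd_sum_units[OF assms single_unit that] .
  have odd_trivial: "h = 0" if "odd m" "group_multiple m h = 0" for m and h :: 'g
  proof -
    let ?N = "\<Sum>i<m. ?s (group_multiple i h)"
    from geometric[OF that(1), of h] obtain w where w: "?N * w = 1"
      by (auto simp: ring_units_def)
    \<comment> \<open>Multiplication by \<open>?s h\<close> shifts the index by one, so the sum
      telescopes to the difference of the terms at \<open>m\<close> and 0, which agree since
      \<open>group_multiple m h = 0\<close>.\<close>
    have "(?s h - 1) * ?N = (\<Sum>i<m. ?s (group_multiple (Suc i) h) - ?s (group_multiple i h))"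
      by (simp add: sum_distrib_left left_diff_distrib mult_single)
    also have "\<dots> = 0"
      using that(2) sum_lessThan_telescope[of "\<lambda>i. ?s (group_multiple i h)" m] by simp
    finally have "(?s h - 1) * (?N * w) = 0"
      by (simp flip: mult.assoc)
    \<comment> \<open>Cancelling \<open>?N\<close> by its inverse \<open>w\<close> leaves
      \<open>?s h = 1\<close>; the coefficient at the identity detects \<open>h = 0\<close> because
      0 and 1 differ in the coefficient ring.\<close>
    then have "Poly_Mapping.lookup (?s h) 0 = Poly_Mapping.lookup 1 0"
      by (simp add: w)
    then show ?thesis
      by (auto simp: lookup_single lookup_one when_def split: if_splits)
  qed
  have "\<exists>k. group_element_order g = 2 ^ k" for g :: 'g
  proof -
    let ?P = "\<lambda>n. n > 0 \<and> group_multiple n g = 0"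
    have ex: "\<exists>n>0. group_multiple n g = 0"
    proof (rule ccontr)
      assume "\<not> ?thesis"
      then have inf: "group_multiple n g \<noteq> 0" if "n > 0" for n
        using that by blast
      have "odd (3 :: nat)"
        by simp
      from geometric[OF this, of g]
      obtain v where "(\<Sum>i<3. ?s (group_multiple i g)) * v = 1"
        unfolding ring_units_def by blast
      with trinomial_no_right_inverse[OF inf] show False
        by blast
    qed
    define n where "n = (LEAST n. ?P n)"
    have n: "?P n"
      unfolding n_def using ex by (rule LeastI_ex)
    have nz: "n \<noteq> 0" "\<not> is_unit (2 :: nat)"
      using n by simp_all
    obtain k m where km: "n = 2 ^ k * m" "odd m"
      by (rule multiplicity_decompose'[OF nz]) (rule that)
    have "group_multiple m (group_multiple (2 ^ k) g) = 0"
      using n unfolding km(1) by (simp add: mult.commute flip: group_multiple_mult)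
    \<comment> \<open>The multiple \<open>group_multiple (2 ^ k) g\<close> is killed by the odd
      number \<open>m\<close>, hence is 0; minimality of \<open>n\<close> then forces
      \<open>m = 1\<close>.\<close>
    then have "?P (2 ^ k)"
      using odd_trivial[OF km(2)] by simp
    then have "n \<le> 2 ^ k"
      unfolding n_def by (rule Least_le)
    then have "n = 2 ^ k"
      using km n by (cases m) auto
    then show ?thesis
      using ex by (auto simp: group_element_order_def n_def)
  qed
  then show ?thesis
    by (simp add: two_group_def)
qed

end
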